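(* The system operator $A(\beta)=\Omega-\mathrm i\beta B$ is diagonalizable for all $\beta\in[0,\infty)$ except for a finite set of positive values of $\beta$.
   Context: Setting. $N\ge 1$; $\alpha,\eta,\theta,R$ are real $N\times N$ matrices with $\alpha^{\mathrm T}=\alpha>0$, $\eta^{\mathrm T}=\eta\ge0$, $\theta^{\mathrm T}=-\theta$, $R^{\mathrm T}=R\ge0$, and $\operatorname{rank}R>0$. $\sqrt{\cdot}$ denotes the positive semidefinite square root. $\Omega$ and $B$ are the $2N\times2N$ matrices $$\Omega=\begin{bmatrix}-2\mathrm i\sqrt\alpha^{-1}\theta\sqrt\alpha^{-1} & -\mathrm i\Phi^{\mathrm T}\\ \mathrm i\Phi&0\end{bmatrix},\quad \Phi=\sqrt\eta\sqrt\alpha^{-1},\quad B=\begin{bmatrix}\sqrt\alpha^{-1}R\sqrt\alpha^{-1}&0\\0&0\end{bmatrix}.$$ Diagonalizable means diagonalizable over $\mathbb C$. *)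

theory Defs
  imports
    Complex_Main
    "Jordan_Normal_Form.Gauss_Jordan_Elimination"
    "Jordan_Normal_Form.DL_Rank"
begin

(* The equation A^T = A already forces A to be square. *)
definition pos_semidef :: "real mat \<Rightarrow> bool" where
  "pos_semidef A \<longleftrightarrow>
     transpose_mat A = A \<and> (\<forall>x \<in> carrier_vec (dim_row A). 0 \<le> x \<bullet> (A *\<^sub>v x))"

definition pos_def :: "real mat \<Rightarrow> bool" where
  "pos_def A \<longleftrightarrow>
     transpose_mat A = A \<and>
     (\<forall>x \<in> carrier_vec (dim_row A). x \<noteq> 0\<^sub>v (dim_row A) \<longrightarrow> 0 < x \<bullet> (A *\<^sub>v x))"

(* Meaningful for positive semidefinite A, where existence and uniqueness are
   the classical facts about the positive semidefinite square root. *)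
definition mat_sqrt :: "real mat \<Rightarrow> real mat" where
  "mat_sqrt A = (THE S. pos_semidef S \<and> S * S = A)"

(* Used for positive definite A only, where the square root is invertible. *)
definition mat_inv_sqrt :: "real mat \<Rightarrow> real mat" where
  "mat_inv_sqrt A = the (mat_inverse (mat_sqrt A))"

abbreviation cmat :: "real mat \<Rightarrow> complex mat" where
  "cmat \<equiv> map_mat complex_of_real"

definition Phi_mat :: "real mat \<Rightarrow> real mat \<Rightarrow> real mat" where
  "Phi_mat \<alpha> \<eta> = mat_sqrt \<eta> * mat_inv_sqrt \<alpha>"

definition Omega_mat :: "real mat \<Rightarrow> real mat \<Rightarrow> real mat \<Rightarrow> complex mat" where
  "Omega_mat \<alpha> \<eta> \<theta> =
     four_block_mat
       ((- 2 * \<i>) \<cdot>\<^sub>m cmat (mat_inv_sqrt \<alpha> * \<theta> * mat_inv_sqrt \<alpha>))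
       ((- \<i>) \<cdot>\<^sub>m cmat (transpose_mat (Phi_mat \<alpha> \<eta>)))
       (\<i> \<cdot>\<^sub>m cmat (Phi_mat \<alpha> \<eta>))
       (0\<^sub>m (dim_row \<alpha>) (dim_row \<alpha>))"

definition B_mat :: "real mat \<Rightarrow> real mat \<Rightarrow> complex mat" where
  "B_mat \<alpha> R =
     four_block_mat
       (cmat (mat_inv_sqrt \<alpha> * R * mat_inv_sqrt \<alpha>))
       (0\<^sub>m (dim_row \<alpha>) (dim_row \<alpha>))
       (0\<^sub>m (dim_row \<alpha>) (dim_row \<alpha>))
       (0\<^sub>m (dim_row \<alpha>) (dim_row \<alpha>))"

definition system_operator ::
  "real mat \<Rightarrow> real mat \<Rightarrow> real mat \<Rightarrow> real mat \<Rightarrow> real \<Rightarrow> complex mat" where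
  "system_operator \<alpha> \<eta> \<theta> R \<beta> =
     Omega_mat \<alpha> \<eta> \<theta> - (\<i> * complex_of_real \<beta>) \<cdot>\<^sub>m B_mat \<alpha> R"

definition diagonalizable :: "complex mat \<Rightarrow> bool" where
  "diagonalizable A \<longleftrightarrow> (\<exists>D. diagonal_mat D \<and> similar_mat A D)"

end

theory Submission
  imports Defs
    "Jordan_Normal_Form.Jordan_Normal_Form_Existence"
    "Subresultants.Subresultant_Gcd"
    "HOL-Computational_Algebra.Field_as_Ring"
begin

text \<open>
  The pencil \<open>A(z) = \<Omega> + z B\<close> is Hermitian, hence diagonalizable, for every real \<open>z\<close>, and the system
  operator is \<open>A(- \<i> \<beta>)\<close>. Among the bivariate polynomials \<open>q(z, \<lambda>)\<close> that vanish at the eigenvalues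
  of \<open>A(z)\<close> for all but finitely many real \<open>z\<close> (the characteristic polynomial is one), take one of
  minimal degree in \<open>\<lambda>\<close>. By minimality it has no repeated factor, so its discriminant is a nonzero
  polynomial in \<open>z\<close>. The entries of \<open>q(z, A(z))\<close> are polynomials in \<open>z\<close> that vanish at infinitely
  many real points, hence identically. So \<open>A(z)\<close> is annihilated by a polynomial with simple roots,
  and therefore diagonalizable, as soon as \<open>z\<close> is not a root of the discriminant or of the leading
  coefficient of \<open>q\<close>.
\<close>

section \<open>Diagonalizability and Jordan chains\<close>

text \<open>Carrying the diagonal as a function turns products, powers and functions of diagonal
  matrices into pointwise operations on \<open>d\<close>.\<close>

definition diag_fun :: "nat \<Rightarrow> (nat \<Rightarrow> 'a) \<Rightarrow> 'a :: zero mat" where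
  "diag_fun n d = mat n n (\<lambda>(i,j). if i = j then d i else 0)"

lemma diag_fun_carrier [simp]: "diag_fun n d \<in> carrier_mat n n"
  by (simp add: diag_fun_def)

lemma dim_diag_fun [simp]: "dim_row (diag_fun n d) = n" "dim_col (diag_fun n d) = n"
  by (simp_all add: diag_fun_def)

lemma mult_diag_fun:
  fixes A :: "'a :: comm_ring_1 mat"
  assumes "A \<in> carrier_mat m n" "i < m" "j < n"
  shows "(A * diag_fun n d) $$ (i,j) = A $$ (i,j) * d j"
  using assms by (auto simp: diag_fun_def scalar_prod_def if_distrib[of "\<lambda>x. _ * x"]
      cong: if_cong)

lemma diag_fun_mult:
  fixes A :: "'a :: comm_ring_1 mat"
  assumes "A \<in> carrier_mat n m" "i < n" "j < m"
  shows "(diag_fun n d * A) $$ (i,j) = d i * A $$ (i,j)"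
  using assms by (auto simp: diag_fun_def scalar_prod_def if_distrib[of "\<lambda>x. x * _"]
      cong: if_cong)

lemma col_mult_diag_fun:
  fixes A :: "'a :: comm_ring_1 mat"
  assumes A: "A \<in> carrier_mat m n" and j: "j < n"
  shows "col (A * diag_fun n d) j = d j \<cdot>\<^sub>v col A j"
proof (rule eq_vecI)
  fix i assume "i < dim_vec (d j \<cdot>\<^sub>v col A j)"
  then have i: "i < m" using A by simp
  then show "col (A * diag_fun n d) j $ i = (d j \<cdot>\<^sub>v col A j) $ i"
    using mult_diag_fun[OF A i j, of d] A j by (simp add: mult.commute del: index_mult_mat(1))
qed (use A in auto)

lemma diag_fun_mult_diag_fun:
  "diag_fun n d * diag_fun n e = diag_fun n (\<lambda>i. d i * e i :: 'a :: comm_ring_1)"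
  by (intro eq_matI) (auto simp del: index_mult_mat(1)
      simp: mult_diag_fun[of _ n n] diag_fun_def[of n d] diag_fun_def[of n "\<lambda>i. d i * e i"])

lemma diag_fun_pow:
  "diag_fun n d ^\<^sub>m k = diag_fun n (\<lambda>i. d i ^ k :: 'a :: comm_ring_1)"
proof (induction k)
  case 0
  show ?case by (intro eq_matI) (auto simp: diag_fun_def)
next
  case (Suc k)
  then show ?case by (simp add: diag_fun_mult_diag_fun mult.commute)
qed

text \<open>A nonzero off-diagonal entry lies on the superdiagonal of a single Jordan block, and a
  block has constant diagonal. The induction peels off the first block and shifts the remaining
  indices by its size.\<close>

lemma jordan_matrix_offdiag:
  assumes "i < sum_list (map fst n_as)" "j < sum_list (map fst n_as)"
    "i \<noteq> j" "jordan_matrix n_as $$ (i,j) \<noteq> 0"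
  shows "Suc i = j \<and> jordan_matrix n_as $$ (i,j) = 1
    \<and> jordan_matrix n_as $$ (i,i) = jordan_matrix n_as $$ (j,j)"
  using assms
proof (induction n_as arbitrary: i j)
  case (Cons na n_as)
  obtain n a where na: "na = (n,a)" by force
  show ?case
  proof (cases "i < n \<or> j < n")
    case True
    then show ?thesis
      using Cons.prems unfolding na jordan_matrix_Cons by (auto split: if_splits)
  next
    case False
    then have *: "i - n < sum_list (map fst n_as)" "j - n < sum_list (map fst n_as)"
      "i - n \<noteq> j - n"
      using Cons.prems(1-3) na by auto
    have entry: "jordan_matrix (na # n_as) $$ (k,l) = jordan_matrix n_as $$ (k - n,l - n)"
      if "k \<in> {i,j}" "l \<in> {i,j}" for k l
      using that Cons.prems(1,2) False unfolding na jordan_matrix_Cons by auto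
    have "jordan_matrix n_as $$ (i - n,j - n) \<noteq> 0"
      using Cons.prems(4) entry by simp
    from Cons.IH[OF * this] show ?thesis using entry False by auto
  qed
qed simp

text \<open>A Jordan block of size at least two contains a chain \<open>u\<close>, \<open>w\<close>,
  so excluding chains makes the Jordan form diagonal. The conclusion is spelled out because it is
  also needed over the reals, where \<open>diagonalizable\<close> does not apply.\<close>

lemma similar_diagonal_if_no_chain:
  fixes A :: "'a :: conjugatable_ordered_field mat"
  assumes A: "A \<in> carrier_mat n n"
    and lin: "char_poly A = (\<Prod>a\<leftarrow>es. [:- a, 1:])"
    and no_chain: "\<And>u w l. u \<in> carrier_vec n \<Longrightarrow> w \<in> carrier_vec n \<Longrightarrow>
      A *\<^sub>v u = l \<cdot>\<^sub>v u \<Longrightarrow> A *\<^sub>v w = l \<cdot>\<^sub>v w + u \<Longrightarrow> u = 0\<^sub>v n"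
  shows "\<exists>D. diagonal_mat D \<and> similar_mat A D"
proof -
  from jordan_nf_exists[OF A lin] obtain n_as where "jordan_nf A n_as" ..
  then obtain P Q where wit: "similar_mat_wit A (jordan_matrix n_as) P Q"
    unfolding jordan_nf_def similar_mat_def by auto
  define J where "J = jordan_matrix n_as"
  note w = similar_mat_witD2[OF A wit[folded J_def]]
  have P: "P \<in> carrier_mat n n" and Q: "Q \<in> carrier_mat n n" and J: "J \<in> carrier_mat n n"
    and QP: "Q * P = 1\<^sub>m n" and AP: "A = P * J * Q" using w by auto
  have n: "n = sum_list (map fst n_as)" using J unfolding J_def by auto
  \<comment> \<open>\<open>P\<close> intertwines \<open>J\<close> and \<open>A\<close>, so a chain
    of unit vectors for \<open>J\<close> becomes a chain for \<open>A\<close>.\<close>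
  have mult: "A *\<^sub>v (P *\<^sub>v x) = P *\<^sub>v (J *\<^sub>v x)" if "x \<in> carrier_vec n" for x
  proof -
    have "A *\<^sub>v (P *\<^sub>v x) = P *\<^sub>v (J *\<^sub>v (Q *\<^sub>v (P *\<^sub>v x)))"
      using P Q J that unfolding AP by (simp add: assoc_mult_mat_vec[of _ n n _ n])
    also have "Q *\<^sub>v (P *\<^sub>v x) = x"
      using assoc_mult_mat_vec[OF Q P that] QP that by simp
    finally show ?thesis .
  qed
  have "diagonal_mat J"
  proof (rule ccontr)
    assume "\<not> diagonal_mat J"
    then obtain i\<^sub>0 j\<^sub>0 where "i\<^sub>0 < n" "j\<^sub>0 < n" "i\<^sub>0 \<noteq> j\<^sub>0" "J $$ (i\<^sub>0,j\<^sub>0) \<noteq> 0"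
      using J unfolding diagonal_mat_def by auto
    then have ex: "\<exists>j. j < n \<and> (\<exists>i<n. i \<noteq> j \<and> J $$ (i,j) \<noteq> 0)" by blast
    \<comment> \<open>At the first off-diagonal entry, the column to its left is still an eigenvector.\<close>
    define j where "j = (LEAST j. j < n \<and> (\<exists>i<n. i \<noteq> j \<and> J $$ (i,j) \<noteq> 0))"
    from LeastI_ex[OF ex, folded j_def] obtain i
      where i: "i < n" "j < n" "i \<noteq> j" "J $$ (i,j) \<noteq> 0" by auto
    note off = jordan_matrix_offdiag[of _ n_as, folded n J_def]
    have ij: "Suc i = j" "J $$ (i,j) = 1" "J $$ (i,i) = J $$ (j,j)" using off[OF i] by auto
    have min: "J $$ (k,i) = 0" if "k < n" "k \<noteq> i" for k
    proof -
      have "i < j" using ij(1) by simp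
      from not_less_Least[OF this[unfolded j_def]] show ?thesis using that i(1) by blast
    qed
    have Ji: "J *\<^sub>v unit_vec n i = J $$ (i,i) \<cdot>\<^sub>v unit_vec n i"
      using min J i by (intro eq_vecI) auto
    have Jj: "J *\<^sub>v unit_vec n j = J $$ (i,i) \<cdot>\<^sub>v unit_vec n j + unit_vec n i"
    proof (intro eq_vecI)
      fix k assume k: "k < dim_vec (J $$ (i,i) \<cdot>\<^sub>v unit_vec n j + unit_vec n i)"
      then have "k < n" by simp
      moreover have "J $$ (k,j) = 0" if "k \<noteq> i" "k \<noteq> j"
        using off[of k j] that i ij \<open>k < n\<close> by auto
      ultimately show "(J *\<^sub>v unit_vec n j) $ k = (J $$ (i,i) \<cdot>\<^sub>v unit_vec n j + unit_vec n i) $ k"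
        using i ij J by auto
    qed (use J in auto)
    have "P *\<^sub>v unit_vec n i = 0\<^sub>v n"
    proof (rule no_chain)
      show "A *\<^sub>v (P *\<^sub>v unit_vec n i) = J $$ (i,i) \<cdot>\<^sub>v (P *\<^sub>v unit_vec n i)"
        using P i by (simp add: mult Ji mult_mat_vec)
      show "A *\<^sub>v (P *\<^sub>v unit_vec n j) = J $$ (i,i) \<cdot>\<^sub>v (P *\<^sub>v unit_vec n j) + P *\<^sub>v unit_vec n i"
        using P i by (simp add: mult Jj mult_mat_vec mult_add_distrib_mat_vec[of _ n n])
    qed (use P in auto)
    then have "Q *\<^sub>v (P *\<^sub>v unit_vec n i) = 0\<^sub>v n"
      using Q by (intro eq_vecI) auto
    moreover have "Q *\<^sub>v (P *\<^sub>v unit_vec n i) = unit_vec n i"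
      using assoc_mult_mat_vec[OF Q P, of "unit_vec n i"] QP by simp
    ultimately have "unit_vec n i $ i = (0\<^sub>v n :: 'a vec) $ i" by simp
    then show False using i by simp
  qed
  then show ?thesis using wit unfolding J_def similar_mat_def by blast
qed

lemma similar_diagonalE:
  fixes A :: "'a :: comm_ring_1 mat"
  assumes A: "A \<in> carrier_mat n n" and "\<exists>D. diagonal_mat D \<and> similar_mat A D"
  obtains P Q d where "P \<in> carrier_mat n n" "Q \<in> carrier_mat n n"
    "P * Q = 1\<^sub>m n" "Q * P = 1\<^sub>m n" "A = P * diag_fun n d * Q"
proof -
  from assms obtain D P Q where D: "diagonal_mat D" and wit: "similar_mat_wit A D P Q"
    unfolding similar_mat_def by auto
  note w = similar_mat_witD2[OF A wit]
  have "diag_fun n (\<lambda>i. D $$ (i,i)) = D"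
    using D w unfolding diagonal_mat_def diag_fun_def by (intro eq_matI) auto
  then show thesis by (intro that[of P Q "\<lambda>i. D $$ (i,i)"]) (use w in auto)
qed

lemma eigenvector_diag_fun_similar:
  fixes A :: "'a :: field mat"
  assumes P: "P \<in> carrier_mat n n" and Q: "Q \<in> carrier_mat n n" and QP: "Q * P = 1\<^sub>m n"
    and A: "A = P * diag_fun n d * Q" and j: "j < n"
  shows "A *\<^sub>v col P j = d j \<cdot>\<^sub>v col P j" "col P j \<noteq> 0\<^sub>v n"
proof -
  have "A * P = P * diag_fun n d * (Q * P)"
    unfolding A using P Q mult_carrier_mat[OF P diag_fun_carrier]
    by (intro assoc_mult_mat[of _ n n _ n _ n]) auto
  also have "\<dots> = P * diag_fun n d"
    using right_mult_one_mat[OF mult_carrier_mat[OF P diag_fun_carrier]] by (simp add: QP)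
  finally have "col (A * P) j = d j \<cdot>\<^sub>v col P j"
    using col_mult_diag_fun[OF P j] by simp
  moreover have "A \<in> carrier_mat n n"
    unfolding A using P Q by (intro mult_carrier_mat[of _ n n _ n] diag_fun_carrier)
  ultimately show "A *\<^sub>v col P j = d j \<cdot>\<^sub>v col P j"
    using col_mult2[OF _ P j] by metis
  show "col P j \<noteq> 0\<^sub>v n"
  proof
    assume "col P j = 0\<^sub>v n"
    then have "(Q * P) $$ (j,j) = 0"
      using j carrier_matD[OF P] carrier_matD[OF Q] scalar_prod_right_zero[of "row Q j" n]
      by (simp add: carrier_vecI)
    then show False using j QP by simp
  qed
qed

section \<open>Self-adjoint matrices, real and complex alike\<close>

lemma self_adjoint_scalar:
  fixes A :: "'a :: conjugatable_ordered_field mat"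
  assumes A: "A \<in> carrier_mat n n" and adj: "map_mat conjugate (transpose_mat A) = A"
    and x: "x \<in> carrier_vec n" and y: "y \<in> carrier_vec n"
  shows "(A *\<^sub>v x) \<bullet>c y = x \<bullet>c (A *\<^sub>v y)"
proof -
  have entry: "conjugate (A $$ (i,j)) = A $$ (j,i)" if "i < n" "j < n" for i j
    using arg_cong[OF adj, of "\<lambda>B. B $$ (j,i)"] A that by simp
  have "conjugate (row A i) = col A i" if "i < n" for i
    using A that entry by (intro eq_vecI) auto
  then have conj: "conjugate (A *\<^sub>v y) = transpose_mat A *\<^sub>v conjugate y"
    using A y by (intro eq_vecI) (auto simp: conjugate_sprod_vec[of _ n])
  have "x \<bullet>c (A *\<^sub>v y) = (transpose_mat A *\<^sub>v conjugate y) \<bullet> x"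
    unfolding conj using A x y by (intro comm_scalar_prod[of _ n]) auto
  also have "\<dots> = conjugate y \<bullet> (A *\<^sub>v x)"
    using A x y by (intro transpose_vec_mult_scalar[of _ n n]) auto
  also have "\<dots> = (A *\<^sub>v x) \<bullet>c y"
    using A x y by (intro comm_scalar_prod[of _ n]) auto
  finally show ?thesis ..
qed

lemma self_adjoint_eigenvalue:
  fixes A :: "'a :: conjugatable_ordered_field mat"
  assumes A: "A \<in> carrier_mat n n" and adj: "map_mat conjugate (transpose_mat A) = A"
    and u: "u \<in> carrier_vec n" "u \<noteq> 0\<^sub>v n" "A *\<^sub>v u = l \<cdot>\<^sub>v u"
  shows "conjugate l = l"
proof -
  have "l * (u \<bullet>c u) = (A *\<^sub>v u) \<bullet>c u" using u by simp
  also have "\<dots> = u \<bullet>c (A *\<^sub>v u)" using self_adjoint_scalar[OF A adj u(1) u(1)] .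
  also have "\<dots> = conjugate l * (u \<bullet>c u)" using u by (simp add: conjugate_smult_vec)
  finally show ?thesis using u by simp
qed

text \<open>Pairing \<open>A w\<close> with \<open>u\<close> gives \<open>l <w,u> + <u,u>\<close>,
  while moving \<open>A\<close> to the other side gives \<open>l <w,u>\<close>, because
  \<open>l\<close> equals its conjugate. Hence \<open><u,u> = 0\<close>.\<close>

lemma self_adjoint_no_chain:
  fixes A :: "'a :: conjugatable_ordered_field mat"
  assumes A: "A \<in> carrier_mat n n" and adj: "map_mat conjugate (transpose_mat A) = A"
    and u: "u \<in> carrier_vec n" "A *\<^sub>v u = l \<cdot>\<^sub>v u"
    and w: "w \<in> carrier_vec n" "A *\<^sub>v w = l \<cdot>\<^sub>v w + u"
  shows "u = 0\<^sub>v n"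
proof (rule ccontr)
  assume u0: "u \<noteq> 0\<^sub>v n"
  note l = self_adjoint_eigenvalue[OF A adj u(1) u0 u(2)]
  have "l * (w \<bullet>c u) + u \<bullet>c u = (A *\<^sub>v w) \<bullet>c u"
    unfolding w(2) using u w(1) by (subst add_scalar_prod_distrib[of _ n]) auto
  also have "\<dots> = w \<bullet>c (A *\<^sub>v u)" using self_adjoint_scalar[OF A adj w(1) u(1)] .
  also have "\<dots> = l * (w \<bullet>c u)" using u w(1) l by (simp add: conjugate_smult_vec)
  finally have "u \<bullet>c u = 0" by simp
  then show False using u(1) u0 by simp
qed

text \<open>The characteristic polynomial splits over the complex numbers, self-adjointness makes
  its roots real, and injectivity of the embedding brings the factorization back to the
  reals.\<close>

lemma symmetric_real_diagonalizable:
  fixes A :: "real mat"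
  assumes A: "A \<in> carrier_mat n n" and sym: "transpose_mat A = A"
  shows "\<exists>D. diagonal_mat D \<and> similar_mat A D"
proof -
  interpret rp: map_poly_inj_idom_hom complex_of_real ..
  have cA: "cmat A \<in> carrier_mat n n" using A by simp
  have A_entry: "A $$ (j,i) = A $$ (i,j)" if "i < n" "j < n" for i j
    using arg_cong[OF sym, of "\<lambda>B. B $$ (i,j)"] A that by simp
  have cadj: "map_mat conjugate (transpose_mat (cmat A)) = cmat A"
    using A A_entry by (intro eq_matI) auto
  have radj: "map_mat conjugate (transpose_mat A) = A"
    using A A_entry by (intro eq_matI) auto
  obtain es where es: "char_poly (cmat A) = (\<Prod>a\<leftarrow>es. [:- a, 1:])"
    using char_poly_factorized[OF cA] by auto
  have real: "complex_of_real (Re a) = a" if "a \<in> set es" for a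
  proof -
    have "poly (char_poly (cmat A)) a = 0"
      unfolding es poly_prod_list using that by auto
    then obtain v where "eigenvector (cmat A) v a"
      using eigenvalue_root_char_poly[OF cA] unfolding eigenvalue_def by blast
    then have "conjugate a = a"
      using self_adjoint_eigenvalue[OF cA cadj] A unfolding eigenvector_def by auto
    then show ?thesis by (simp add: complex_eq_iff)
  qed
  have "map_poly complex_of_real (char_poly A) = (\<Prod>a\<leftarrow>es. [:- a, 1:])"
    using of_real_hom.char_poly_hom[OF A] es by metis
  also have "\<dots> = (\<Prod>a\<leftarrow>es. map_poly complex_of_real [:- Re a, 1:])"
    using real by (intro arg_cong[of _ _ prod_list] map_cong) auto
  also have "\<dots> = map_poly complex_of_real (\<Prod>a\<leftarrow>map Re es. [:- a, 1:])"
    by (simp add: rp.hom_prod_list o_def)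
  finally have "char_poly A = (\<Prod>a\<leftarrow>map Re es. [:- a, 1:])"
    by (simp only: rp.eq_iff)
  then show ?thesis
    by (rule similar_diagonal_if_no_chain[OF A]) (use self_adjoint_no_chain[OF A radj] in blast)
qed

section \<open>Positive semidefinite square roots\<close>

lemma similarity_mult:
  fixes P Q D E :: "'a :: comm_ring_1 mat"
  assumes [simp]: "P \<in> carrier_mat n n" "Q \<in> carrier_mat n n" "D \<in> carrier_mat n n" "E \<in> carrier_mat n n"
    and QP: "Q * P = 1\<^sub>m n"
  shows "(P * D * Q) * (P * E * Q) = P * (D * E) * Q"
proof -
  have "Q * (P * X) = X" if "X \<in> carrier_mat n n" for X
    using assoc_mult_mat[of Q n n P n X n] QP that by simp
  then show ?thesis
    by (simp add: assoc_mult_mat[of _ n n _ n _ n] mult_carrier_mat[of _ n n _ n])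
qed

text \<open>The Gram matrix \<open>P\<^sup>T P\<close> commutes with the diagonal matrix, hence with every function of it.\<close>

lemma symmetric_diag_fun_similar:
  fixes P Q :: "real mat"
  assumes P [simp]: "P \<in> carrier_mat n n" and Q [simp]: "Q \<in> carrier_mat n n"
    and PQ: "P * Q = 1\<^sub>m n" and QP: "Q * P = 1\<^sub>m n"
    and sym: "transpose_mat (P * diag_fun n d * Q) = P * diag_fun n d * Q"
  shows "transpose_mat (P * diag_fun n (\<lambda>i. f (d i)) * Q) = P * diag_fun n (\<lambda>i. f (d i)) * Q"
proof -
  define G where "G = transpose_mat P * P"
  note [simp] = mult_carrier_mat[of _ n n _ n] right_mult_one_mat[of _ n n] left_mult_one_mat[of _ n n]
  have G [simp]: "G \<in> carrier_mat n n" by (simp add: G_def)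
  note carrier_matD[OF G, simp]
  have tP [simp]: "transpose_mat P \<in> carrier_mat n n" "transpose_mat Q \<in> carrier_mat n n" by simp_all
  have tdiag: "transpose_mat (diag_fun n e) = diag_fun n e" for e :: "nat \<Rightarrow> real"
    by (intro eq_matI) (auto simp: diag_fun_def)
  have tQP: "transpose_mat P * transpose_mat Q = 1\<^sub>m n"
    using arg_cong[OF QP, of transpose_mat] by (simp add: transpose_mult[of _ n n _ n])
  have tPQ: "transpose_mat Q * transpose_mat P = 1\<^sub>m n"
    using arg_cong[OF PQ, of transpose_mat] by (simp add: transpose_mult[of _ n n _ n])
  note assoc = assoc_mult_mat[of _ n n _ n _ n]
  have "G * diag_fun n d = transpose_mat P * (P * diag_fun n d * Q) * P"
    by (simp add: G_def assoc QP)
  also have "\<dots> = transpose_mat P * transpose_mat (P * diag_fun n d * Q) * P"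
    by (simp only: sym)
  also have "\<dots> = (transpose_mat P * transpose_mat Q) * (diag_fun n d * G)"
    by (simp add: transpose_mult[of _ n n _ n] tdiag G_def assoc)
  also have "\<dots> = diag_fun n d * G" by (simp add: tQP)
  finally have comm: "G * diag_fun n d = diag_fun n d * G" .
  have "G $$ (i,j) * d j = d i * G $$ (i,j)" if "i < n" "j < n" for i j
    using arg_cong[OF comm, of "\<lambda>B. B $$ (i,j)"] that
    by (simp add: mult_diag_fun[of _ n n] diag_fun_mult[of _ n n] del: index_mult_mat(1))
  \<comment> \<open>A nonzero entry of \<open>G\<close> links equal values of \<open>d\<close>,
    hence equal values of \<open>f\<close> at them; this is why commutation survives applying
    \<open>f\<close>.\<close>
  then have "G $$ (i,j) = 0 \<or> d i = d j" if "i < n" "j < n" for i j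
    using that by (metis mult.commute mult_cancel_left)
  then have "G $$ (i,j) * f (d j) = f (d i) * G $$ (i,j)" if "i < n" "j < n" for i j
    using that by fastforce
  then have comm: "G * diag_fun n (\<lambda>i. f (d i)) = diag_fun n (\<lambda>i. f (d i)) * G" (is "G * ?D = _")
    by (intro eq_matI) (auto simp: mult_diag_fun[of _ n n] diag_fun_mult[of _ n n]
        simp del: index_mult_mat(1))
  \<comment> \<open>Inserting \<open>P * Q = 1\<close> on the right makes \<open>G\<close> appear;
    the diagonal matrix is then moved past it.\<close>
  have "transpose_mat (P * ?D * Q) = transpose_mat Q * ?D * transpose_mat P * (P * Q)"
    by (simp add: PQ transpose_mult[of _ n n _ n] tdiag assoc)
  also have "\<dots> = transpose_mat Q * (?D * G) * Q"
    by (simp add: G_def assoc)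
  also have "\<dots> = transpose_mat Q * transpose_mat P * (P * ?D * Q)"
    by (simp add: comm[symmetric]) (simp add: G_def assoc)
  also have "\<dots> = P * ?D * Q" by (simp add: tPQ)
  finally show ?thesis .
qed

lemma self_adjoint_real:
  fixes A :: "real mat"
  assumes A: "A \<in> carrier_mat n n" and sym: "transpose_mat A = A"
    and x: "x \<in> carrier_vec n" and y: "y \<in> carrier_vec n"
  shows "(A *\<^sub>v x) \<bullet> y = x \<bullet> (A *\<^sub>v y)"
  using transpose_vec_mult_scalar[OF A y x] unfolding sym .

lemma scalar_prod_self_nonpos:
  fixes x :: "real vec"
  assumes "x \<in> carrier_vec n" "x \<bullet> x \<le> 0"
  shows "x = 0\<^sub>v n"
proof -
  have "conjugate x = x" by (intro eq_vecI) auto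
  moreover have "0 \<le> x \<bullet> x" unfolding scalar_prod_def by (intro sum_nonneg) auto
  ultimately show ?thesis
    using assms conjugate_square_eq_0_vec[OF assms(1)] by simp
qed

text \<open>Since \<open>(S + s)(S - s) v = 0\<close>, the vector \<open>y = S v - s v\<close>
  satisfies \<open>S y = - s y\<close>, and semidefiniteness forces \<open>y = 0\<close> when
  \<open>s > 0\<close>. For \<open>s = 0\<close> the squared norm of \<open>y\<close> is the product
  of \<open>v\<close> with \<open>S S v = 0\<close>.\<close>

lemma pos_semidef_sqrt_eigenvector:
  assumes S: "S \<in> carrier_mat n n" and psd: "pos_semidef S"
    and v: "v \<in> carrier_vec n" and SS: "(S * S) *\<^sub>v v = (s * s) \<cdot>\<^sub>v v" and s: "0 \<le> s"
  shows "S *\<^sub>v v = s \<cdot>\<^sub>v v"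
proof -
  have sym: "transpose_mat S = S" using psd unfolding pos_semidef_def by simp
  define y where "y = S *\<^sub>v v - s \<cdot>\<^sub>v v"
  have y [simp]: "y \<in> carrier_vec n" using S v by (simp add: y_def)
  have SSv: "S *\<^sub>v (S *\<^sub>v v) = (s * s) \<cdot>\<^sub>v v" using S v SS by simp
  have "y \<bullet> y \<le> 0"
  proof (cases "s = 0")
    case True
    have "y = S *\<^sub>v v" using True S v by (intro eq_vecI) (auto simp: y_def)
    then have "y \<bullet> y = v \<bullet> (S *\<^sub>v (S *\<^sub>v v))"
      using self_adjoint_real[OF S sym v, of "S *\<^sub>v v"] S v by simp
    then show ?thesis using v True by (simp add: SSv)
  next
    case False
    have "S *\<^sub>v y = S *\<^sub>v (S *\<^sub>v v) - S *\<^sub>v (s \<cdot>\<^sub>v v)"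
      unfolding y_def using S v by (intro mult_minus_distrib_mat_vec[of _ n n]) auto
    also have "\<dots> = (s * s) \<cdot>\<^sub>v v - s \<cdot>\<^sub>v (S *\<^sub>v v)"
      using S v by (simp add: SSv mult_mat_vec)
    also have "\<dots> = (- s) \<cdot>\<^sub>v y"
      using S v by (intro eq_vecI) (auto simp: y_def algebra_simps)
    finally have "S *\<^sub>v y = (- s) \<cdot>\<^sub>v y" .
    moreover have "0 \<le> y \<bullet> (S *\<^sub>v y)" using psd S unfolding pos_semidef_def by simp
    ultimately have "s * (y \<bullet> y) \<le> 0" by simp
    then show ?thesis using False s by (simp add: mult_le_0_iff)
  qed
  then have "y = 0\<^sub>v n" using scalar_prod_self_nonpos[OF y] by simp
  then have "y $ i = 0" if "i < n" for i using that by simp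
  then show ?thesis using S v unfolding y_def by (intro eq_vecI) auto
qed

text \<open>
  The definite description in \<^const>\<open>mat_sqrt\<close> denotes nothing useful without uniqueness: any positive
  semidefinite square root acts as \<open>\<surd>d\<close> on each eigenvector for \<open>d\<close>, and these span.
\<close>

lemma mat_sqrt_pos_semidef:
  assumes A: "A \<in> carrier_mat n n" and psd: "pos_semidef A"
  shows "pos_semidef (mat_sqrt A)" "mat_sqrt A * mat_sqrt A = A" "mat_sqrt A \<in> carrier_mat n n"
proof -
  have sym: "transpose_mat A = A" using psd unfolding pos_semidef_def by simp
  obtain P Q d where P [simp]: "P \<in> carrier_mat n n" and Q [simp]: "Q \<in> carrier_mat n n"
    and PQ: "P * Q = 1\<^sub>m n" and QP: "Q * P = 1\<^sub>m n" and AP: "A = P * diag_fun n d * Q"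
    using that by (rule similar_diagonalE[OF A symmetric_real_diagonalizable[OF A sym]])
  note [simp] = mult_carrier_mat[of _ n n _ n] right_mult_one_mat[of _ n n] left_mult_one_mat[of _ n n]
  note assoc = assoc_mult_mat[of _ n n _ n _ n]
  note eig = eigenvector_diag_fun_similar(1)[OF P Q QP AP]
  \<comment> \<open>The quadratic form of \<open>A\<close> at column \<open>j\<close> of
    \<open>P\<close> is \<open>d j\<close> times the squared norm of a nonzero vector.\<close>
  have d: "0 \<le> d j" if "j < n" for j
  proof (rule ccontr)
    assume "\<not> 0 \<le> d j"
    moreover have "0 \<le> col P j \<bullet> (A *\<^sub>v col P j)"
      using psd A that P unfolding pos_semidef_def by simp
    then have "0 \<le> d j * (col P j \<bullet> col P j)" using that P by (simp add: eig)
    ultimately have "col P j \<bullet> col P j \<le> 0" by (simp add: zero_le_mult_iff)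
    then have "col P j = 0\<^sub>v n" using scalar_prod_self_nonpos[of "col P j" n] that P by simp
    then show False using eigenvector_diag_fun_similar(2)[OF P Q QP AP that] by simp
  qed
  \<comment> \<open>This is the functional calculus \<open>f(A)\<close>: symmetric and
    multiplicative for every \<open>f\<close>, and dependent only on the values of \<open>f\<close>
    at nonnegative arguments.\<close>
  define root where "root f = P * diag_fun n (\<lambda>i. f (d i)) * Q" for f
  have root [simp]: "root f \<in> carrier_mat n n" for f unfolding root_def by simp
  have root_sym: "transpose_mat (root f) = root f" for f
    unfolding root_def by (rule symmetric_diag_fun_similar[OF P Q PQ QP sym[unfolded AP]])
  have root_mult: "root f * root g = root (\<lambda>x. f x * g x)" for f g
    unfolding root_def 
    by (simp only: similarity_mult[OF P Q diag_fun_carrier diag_fun_carrier QP] diag_fun_mult_diag_fun)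
  have root_cong: "root f = root g" if "\<And>x. 0 \<le> x \<Longrightarrow> f x = g x" for f g
  proof -
    have "diag_fun n (\<lambda>i. f (d i)) = diag_fun n (\<lambda>i. g (d i))"
      using that d by (intro eq_matI) (auto simp: diag_fun_def)
    then show ?thesis by (simp add: root_def)
  qed
  have AP': "A = root (\<lambda>x. x)" by (simp add: root_def AP)
  have root_sq: "root sqrt * root sqrt = A"
    unfolding root_mult AP' by (rule root_cong) simp
  have root_psd: "pos_semidef (root sqrt)"
    unfolding pos_semidef_def
  proof (intro conjI ballI root_sym)
    fix x :: "real vec" assume "x \<in> carrier_vec (dim_row (root sqrt))"
    then have x [simp]: "x \<in> carrier_vec n" using root[of sqrt] by simp
    \<comment> \<open>A symmetric fourth root of \<open>A\<close> turns the quadratic form of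
      \<open>root sqrt\<close> into a squared norm.\<close>
    let ?T = "root (\<lambda>x. sqrt (sqrt x))"
    have "?T * ?T = root sqrt" unfolding root_mult by (rule root_cong) simp
    then have "x \<bullet> (root sqrt *\<^sub>v x) = x \<bullet> (?T *\<^sub>v (?T *\<^sub>v x))"
      using assoc_mult_mat_vec[OF root root x, of "\<lambda>x. sqrt (sqrt x)" "\<lambda>x. sqrt (sqrt x)"]
      by (simp only:)
    also have "\<dots> = (?T *\<^sub>v x) \<bullet> (?T *\<^sub>v x)"
      by (rule self_adjoint_real[OF root root_sym x mult_mat_vec_carrier[OF root x], symmetric])
    also have "\<dots> \<ge> 0" unfolding scalar_prod_def by (intro sum_nonneg) auto
    finally show "0 \<le> x \<bullet> (root sqrt *\<^sub>v x)" .
  qed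
  have "mat_sqrt A = root sqrt"
    unfolding mat_sqrt_def
  proof (rule the_equality, intro conjI root_psd root_sq)
    fix S assume S: "pos_semidef S \<and> S * S = A"
    then have SS: "S * S = A" by simp
    \<comment> \<open>The description in \<open>mat_sqrt\<close> fixes no dimensions; they are
      recovered from \<open>S * S = A\<close>.\<close>
    have Sc [simp]: "S \<in> carrier_mat n n"
      using arg_cong[OF SS, of dim_row] arg_cong[OF SS, of dim_col] A by auto
    have "S * P = P * diag_fun n (\<lambda>i. sqrt (d i))"
    proof (intro mat_col_eqI)
      fix j assume "j < dim_col (P * diag_fun n (\<lambda>i. sqrt (d i)))"
      then have j: "j < n" by (simp add: diag_fun_def)
      have "col (S * P) j = S *\<^sub>v col P j" using col_mult2[OF Sc P j] .
      also have "\<dots> = sqrt (d j) \<cdot>\<^sub>v col P j"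
      proof (rule pos_semidef_sqrt_eigenvector[OF Sc])
        show "S * S *\<^sub>v col P j = (sqrt (d j) * sqrt (d j)) \<cdot>\<^sub>v col P j"
          unfolding SS eig[OF j] using d[OF j] by simp
      qed (use S d[OF j] j P in auto)
      also have "\<dots> = col (P * diag_fun n (\<lambda>i. sqrt (d i))) j"
        using col_mult_diag_fun[OF P j, of "\<lambda>i. sqrt (d i)"] by simp
      finally show "col (S * P) j = col (P * diag_fun n (\<lambda>i. sqrt (d i))) j" .
    qed (use carrier_matD[OF P] carrier_matD[OF Sc] in auto)
    then have "S * P * Q = root sqrt" by (simp add: root_def)
    then show "S = root sqrt" by (simp add: assoc PQ)
  qed
  then show "pos_semidef (mat_sqrt A)" "mat_sqrt A * mat_sqrt A = A" "mat_sqrt A \<in> carrier_mat n n"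
    using root_psd root_sq root by simp_all
qed

lemma pos_def_imp_pos_semidef:
  assumes "pos_def A"
  shows "pos_semidef A"
proof -
  have "0 \<le> x \<bullet> (A *\<^sub>v x)" if x: "x \<in> carrier_vec (dim_row A)" for x
  proof (cases "x = 0\<^sub>v (dim_row A)")
    case True
    then show ?thesis
      using scalar_prod_left_zero[of "A *\<^sub>v x" "dim_row A"] by (simp add: carrier_vecI)
  next
    case False
    then show ?thesis using assms x unfolding pos_def_def by (blast intro: less_imp_le)
  qed
  then show ?thesis using assms unfolding pos_def_def pos_semidef_def by blast
qed

text \<open>A kernel vector of the root would be a kernel vector of \<open>A\<close>, so the root is
  invertible and \<open>the\<close> is applied to a proper value. Symmetry passes to the inverse
  \<open>B\<close> of the root \<open>S\<close> through
  \<open>B^T = B^T S B = (S B)^T B = B\<close>.\<close>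

lemma mat_inv_sqrt_pos_def:
  assumes A: "A \<in> carrier_mat n n" and pd: "pos_def A"
  shows "mat_inv_sqrt A \<in> carrier_mat n n" "transpose_mat (mat_inv_sqrt A) = mat_inv_sqrt A"
proof -
  note sq = mat_sqrt_pos_semidef[OF A pos_def_imp_pos_semidef[OF pd]]
  let ?S = "mat_sqrt A"
  have "det ?S \<noteq> 0"
  proof
    assume "det ?S = 0"
    then obtain v where v: "v \<in> carrier_vec n" "v \<noteq> 0\<^sub>v n" "?S *\<^sub>v v = 0\<^sub>v n"
      using det_0_iff_vec_prod_zero_field[OF sq(3)] by auto
    have "A *\<^sub>v v = ?S *\<^sub>v (?S *\<^sub>v v)" using sq(2) assoc_mult_mat_vec[OF sq(3) sq(3) v(1)] by simp
    also have "\<dots> = 0\<^sub>v n" unfolding v(3) using sq(3) by (intro eq_vecI) auto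
    finally have "v \<bullet> (A *\<^sub>v v) = 0" using v(1) by simp
    moreover have "\<forall>x\<in>carrier_vec n. x \<noteq> 0\<^sub>v n \<longrightarrow> 0 < x \<bullet> (A *\<^sub>v x)"
      using pd carrier_matD(1)[OF A] unfolding pos_def_def by simp
    ultimately show False using v(1,2) by force
  qed
  then have "?S \<in> Units (ring_mat TYPE(real) n ())" by (rule det_non_zero_imp_unit[OF sq(3)])
  then obtain B where B: "mat_inverse ?S = Some B"
    using mat_inverse(1)[OF sq(3)] by fastforce
  note inv = mat_inverse(2)[OF sq(3) B]
  have [simp]: "B \<in> carrier_mat n n" "transpose_mat B \<in> carrier_mat n n" using inv by auto
  have Ssym: "transpose_mat ?S = ?S" using sq(1) unfolding pos_semidef_def by simp
  have "transpose_mat B = transpose_mat B * (?S * B)"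
    using inv right_mult_one_mat[of "transpose_mat B" n n] by simp
  also have "\<dots> = transpose_mat (?S * B) * B"
    using sq(3) by (simp add: transpose_mult[of _ n n _ n] Ssym assoc_mult_mat[of _ n n _ n _ n])
  also have "\<dots> = B" using inv left_mult_one_mat[of B n n] by simp
  finally show "mat_inv_sqrt A \<in> carrier_mat n n" "transpose_mat (mat_inv_sqrt A) = mat_inv_sqrt A"
    unfolding mat_inv_sqrt_def B by simp_all
qed

section \<open>Annihilating polynomials\<close>

text \<open>At \<open>k = 0\<close>, where \<open>k - 1\<close> is truncated, the factor
  \<open>of_nat k\<close> kills the term. The shape matches the powers of a matrix on a
  chain.\<close>

lemma poly_pderiv_sum:
  "poly (pderiv p) x = (\<Sum>k\<le>degree p. of_nat k * coeff p k * (x :: 'a :: idom) ^ (k - 1))"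
proof -
  have "pderiv p = (\<Sum>k\<le>degree p. pderiv (monom (coeff p k) k))"
    by (subst poly_as_sum_of_monoms[of p, symmetric]) (simp add: Missing_Polynomial.pderiv_sum)
  then show ?thesis by (simp add: poly_sum pderiv_monom poly_monom)
qed

lemma mult_mat_vec_sum:
  assumes "A \<in> carrier_mat n n" "v \<in> carrier_vec n" "i < n"
  shows "(A *\<^sub>v v) $ i = (\<Sum>j<n. A $$ (i,j) * v $ j)"
  using assms by (auto simp: scalar_prod_def atLeast0LessThan)

text \<open>On a chain, \<open>A^k\<close> produces \<open>l^k\<close> together with its derivative
  in \<open>l\<close>; summing against the coefficients of \<open>p\<close> will give
  \<open>p(l)\<close> and \<open>p'(l)\<close>.\<close>

lemma pow_mult_chain:
  fixes A :: "'a :: field mat"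
  assumes A: "A \<in> carrier_mat n n" and u: "u \<in> carrier_vec n" and w: "w \<in> carrier_vec n"
    and Au: "A *\<^sub>v u = l \<cdot>\<^sub>v u" and Aw: "A *\<^sub>v w = l \<cdot>\<^sub>v w + u"
  shows "A ^\<^sub>m k *\<^sub>v u = l ^ k \<cdot>\<^sub>v u"
    "A ^\<^sub>m k *\<^sub>v w = l ^ k \<cdot>\<^sub>v w + (of_nat k * l ^ (k - 1)) \<cdot>\<^sub>v u"
proof -
  note Ak = pow_carrier_mat[OF A]
  show pu: "A ^\<^sub>m k *\<^sub>v u = l ^ k \<cdot>\<^sub>v u" for k
  proof (induction k)
    case 0
    show ?case using A u by simp
  next
    case (Suc k)
    have "A ^\<^sub>m Suc k *\<^sub>v u = A ^\<^sub>m k *\<^sub>v (A *\<^sub>v u)"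
      using assoc_mult_mat_vec[OF Ak A u] by simp
    also have "\<dots> = l \<cdot>\<^sub>v (l ^ k \<cdot>\<^sub>v u)"
      unfolding Au mult_mat_vec[OF Ak u] Suc ..
    finally show ?case by (simp add: smult_smult_assoc)
  qed
  show "A ^\<^sub>m k *\<^sub>v w = l ^ k \<cdot>\<^sub>v w + (of_nat k * l ^ (k - 1)) \<cdot>\<^sub>v u"
  proof (induction k)
    case 0
    show ?case using A u w by (intro eq_vecI) auto
  next
    case (Suc k)
    have "A ^\<^sub>m Suc k *\<^sub>v w = A ^\<^sub>m k *\<^sub>v (A *\<^sub>v w)"
      using assoc_mult_mat_vec[OF Ak A w] by simp
    also have "\<dots> = A ^\<^sub>m k *\<^sub>v (l \<cdot>\<^sub>v w) + A ^\<^sub>m k *\<^sub>v u"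
      unfolding Aw using Ak u w by (intro mult_add_distrib_mat_vec[of _ n n]) auto
    also have "\<dots> = l \<cdot>\<^sub>v (l ^ k \<cdot>\<^sub>v w + (of_nat k * l ^ (k - 1)) \<cdot>\<^sub>v u) + l ^ k \<cdot>\<^sub>v u"
      unfolding mult_mat_vec[OF Ak w] Suc pu ..
    also have "\<dots> = l ^ Suc k \<cdot>\<^sub>v w + (of_nat (Suc k) * l ^ (Suc k - 1)) \<cdot>\<^sub>v u"
      using u w by (intro eq_vecI) (cases k; auto simp: algebra_simps)+
    finally show ?case .
  qed
qed

text \<open>Applying \<open>p(A) = 0\<close> to the chain gives \<open>p(l) u = 0\<close> and
  \<open>p(l) w + p'(l) u = 0\<close>, read off at a coordinate where \<open>u\<close> is nonzero.
  The equation \<open>p(A) = 0\<close> is stated entrywise so that each entry can later be treated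
  as a polynomial in the pencil parameter.\<close>

lemma annihilator_chain_double_root:
  fixes A :: "'a :: field mat"
  assumes A: "A \<in> carrier_mat n n" and u: "u \<in> carrier_vec n" and w: "w \<in> carrier_vec n"
    and Au: "A *\<^sub>v u = l \<cdot>\<^sub>v u" and Aw: "A *\<^sub>v w = l \<cdot>\<^sub>v w + u" and u0: "u \<noteq> 0\<^sub>v n"
    and ann: "\<And>i j. i < n \<Longrightarrow> j < n \<Longrightarrow> (\<Sum>k\<le>degree p. coeff p k * (A ^\<^sub>m k) $$ (i,j)) = 0"
  shows "poly p l = 0" "poly (pderiv p) l = 0"
proof -
  note Ak = pow_carrier_mat[OF A]
  have ann': "(\<Sum>k\<le>degree p. coeff p k * (A ^\<^sub>m k *\<^sub>v v) $ i) = 0"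
    if v: "v \<in> carrier_vec n" and i: "i < n" for v i
  proof -
    have "(\<Sum>k\<le>degree p. coeff p k * (A ^\<^sub>m k *\<^sub>v v) $ i)
        = (\<Sum>k\<le>degree p. \<Sum>j<n. coeff p k * (A ^\<^sub>m k) $$ (i,j) * v $ j)"
      by (simp only: mult_mat_vec_sum[OF Ak v i] sum_distrib_left mult.assoc)
    also have "\<dots> = (\<Sum>j<n. (\<Sum>k\<le>degree p. coeff p k * (A ^\<^sub>m k) $$ (i,j)) * v $ j)"
      by (subst sum.swap) (simp only: sum_distrib_right)
    also have "\<dots> = 0" using ann i by simp
    finally show ?thesis .
  qed
  obtain i where i: "i < n" "u $ i \<noteq> 0"
    using u u0 by (metis carrier_vecD eq_vecI index_zero_vec(1,2))
  have "poly p l * u $ i = (\<Sum>k\<le>degree p. coeff p k * (A ^\<^sub>m k *\<^sub>v u) $ i)"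
    using u i by (simp add: pow_mult_chain(1)[OF A u w Au Aw] poly_altdef sum_distrib_right mult.assoc)
  then show pl: "poly p l = 0" using ann'[OF u i(1)] i(2) by simp
  have "(A ^\<^sub>m k *\<^sub>v w) $ i = l ^ k * w $ i + of_nat k * l ^ (k - 1) * u $ i" for k
    using u w i by (simp add: pow_mult_chain(2)[OF A u w Au Aw])
  then have "(\<Sum>k\<le>degree p. coeff p k * (A ^\<^sub>m k *\<^sub>v w) $ i)
      = (\<Sum>k\<le>degree p. coeff p k * l ^ k * w $ i + of_nat k * coeff p k * l ^ (k - 1) * u $ i)"
    by (intro sum.cong) (simp_all add: algebra_simps)
  also have "\<dots> = poly p l * w $ i + poly (pderiv p) l * u $ i"
    by (simp only: poly_altdef[of p] poly_pderiv_sum sum.distrib sum_distrib_right)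
  finally show "poly (pderiv p) l = 0" using ann'[OF w i(1)] i(2) pl by simp
qed

text \<open>Here \<open>p(A) = P p(D) Q\<close>, and the diagonal entries of \<open>p(D)\<close> are
  values of \<open>p\<close> at eigenvalues.\<close>

lemma annihilator_diagonal:
  fixes A :: "'a :: field mat"
  assumes A: "A \<in> carrier_mat n n" and diag: "\<exists>D. diagonal_mat D \<and> similar_mat A D"
    and root: "\<And>l. eigenvalue A l \<Longrightarrow> poly p l = 0"
    and i: "i < n" and j: "j < n"
  shows "(\<Sum>k\<le>degree p. coeff p k * (A ^\<^sub>m k) $$ (i,j)) = 0"
proof -
  obtain P Q d where P: "P \<in> carrier_mat n n" and Q: "Q \<in> carrier_mat n n"
    and PQ: "P * Q = 1\<^sub>m n" and QP: "Q * P = 1\<^sub>m n" and AP: "A = P * diag_fun n d * Q"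
    using that by (rule similar_diagonalE[OF A diag])
  have eig: "poly p (d l) = 0" if "l < n" for l
  proof (rule root)
    show "eigenvalue A (d l)"
      using eigenvector_diag_fun_similar[OF P Q QP AP that] P A
      unfolding eigenvalue_def eigenvector_def by (intro exI[of _ "col P l"]) (auto simp: carrier_vecI)
  qed
  have wit: "similar_mat_wit A (diag_fun n d) P Q"
    using A P Q PQ QP AP by (intro similar_mat_witI[of _ _ n]) auto
  have entry: "(A ^\<^sub>m k) $$ (i,j) = (\<Sum>l<n. P $$ (i,l) * d l ^ k * Q $$ (l,j))" for k
  proof -
    have PD: "P * diag_fun n (\<lambda>i. d i ^ k) \<in> carrier_mat n n"
      by (rule mult_carrier_mat[OF P diag_fun_carrier])
    have "(A ^\<^sub>m k) $$ (i,j) = (P * diag_fun n (\<lambda>i. d i ^ k) * Q) $$ (i,j)"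
      using similar_mat_wit_pow_id[OF wit, of k] by (simp add: diag_fun_pow)
    also have "\<dots> = (\<Sum>l<n. (P * diag_fun n (\<lambda>i. d i ^ k)) $$ (i,l) * Q $$ (l,j))"
      using PD Q i j by (subst index_mult_mat(1)) (auto simp: scalar_prod_def atLeast0LessThan)
    also have "\<dots> = (\<Sum>l<n. P $$ (i,l) * d l ^ k * Q $$ (l,j))"
      using mult_diag_fun[OF P i] by (intro sum.cong) auto
    finally show ?thesis .
  qed
  have "(\<Sum>k\<le>degree p. coeff p k * (A ^\<^sub>m k) $$ (i,j))
      = (\<Sum>k\<le>degree p. \<Sum>l<n. P $$ (i,l) * (coeff p k * d l ^ k) * Q $$ (l,j))"
    unfolding entry sum_distrib_left by (intro sum.cong refl) (simp add: mult.assoc mult.left_commute)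
  also have "\<dots> = (\<Sum>l<n. P $$ (i,l) * poly p (d l) * Q $$ (l,j))"
    by (subst sum.swap) (simp only: poly_altdef sum_distrib_left sum_distrib_right)
  also have "\<dots> = 0" using eig by simp
  finally show ?thesis .
qed

section \<open>Specializing the parameter of a bivariate polynomial\<close>

text \<open>The outer variable of \<open>complex poly poly\<close> is the spectral variable, the
  inner one the pencil parameter; only the latter is substituted.\<close>

abbreviation eval_coeffs :: "complex \<Rightarrow> complex poly poly \<Rightarrow> complex poly" where
  "eval_coeffs z \<equiv> map_poly (\<lambda>p. poly p z)"

lemma degree_eval_coeffs:
  assumes "poly (lead_coeff q) z \<noteq> 0"
  shows "degree (eval_coeffs z q) = degree q"
proof (rule antisym)
  show "degree q \<le> degree (eval_coeffs z q)"
    using assms by (intro le_degree) simp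
qed (rule degree_map_poly_le)

text \<open>Dividing \<open>q = g r\<close> by a common factor \<open>g\<close> of \<open>q\<close> and \<open>q'\<close> lowers the order of a root but loses none.\<close>

lemma eval_coeffs_pderiv_gcd:
  assumes q: "eval_coeffs z (g * r) \<noteq> 0" and g: "g dvd pderiv (g * r)"
    and root: "poly (eval_coeffs z (g * r)) l = 0"
  shows "poly (eval_coeffs z r) l = 0"
proof (rule ccontr)
  interpret mp: map_poly_comm_ring_hom "\<lambda>p. poly p z" ..
  let ?q = "eval_coeffs z (g * r)"
  assume r: "poly (eval_coeffs z r) l \<noteq> 0"
  have qgr: "?q = eval_coeffs z g * eval_coeffs z r" by (rule mp.hom_mult)
  have ord: "order l ?q = Suc (order l (pderiv ?q))" by (rule order_pderiv[OF q root])
  have "pderiv ?q \<noteq> 0"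
  proof
    assume "pderiv ?q = 0"
    then obtain c where "?q = [:c:]" using pderiv_eq_0_iff degree_eq_zeroE by metis
    then show False using q root by auto
  qed
  moreover have "eval_coeffs z g dvd pderiv ?q"
    using mp.hom_dvd[OF g] by (simp add: poly_hom.map_poly_pderiv)
  ultimately have "order l (eval_coeffs z g) \<le> order l (pderiv ?q)"
    by (rule dvd_imp_order_le)
  \<comment> \<open>If \<open>r\<close> does not vanish at \<open>l\<close>, then \<open>g\<close>
    carries the full multiplicity of \<open>l\<close>, although it divides the derivative, where the
    multiplicity is one less.\<close>
  moreover have "order l ?q = order l (eval_coeffs z g)"
    using q r unfolding qgr by (simp add: order_mult order_0I)
  ultimately show False using ord by simp
qed

section \<open>Pencils that are diagonalizable at infinitely many points\<close>

text \<open>Otherwise dividing \<open>q\<close> by the gcd would give a good polynomial of smaller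
  degree. Finitely many exceptions are allowed in \<open>good\<close> because the quotient is
  uncontrolled where \<open>q\<close> specializes to zero. The gcd may still be a nonconstant
  polynomial in the parameter alone.\<close>

lemma gcd_pderiv_trivial_if_minimal:
  fixes Z :: "complex set" and q :: "complex poly poly" and ev :: "complex \<Rightarrow> complex set"
  defines "good \<equiv> \<lambda>q. q \<noteq> 0 \<and> finite {z \<in> Z. \<exists>l \<in> ev z. poly (eval_coeffs z q) l \<noteq> 0}"
  assumes q: "good q" and min: "\<And>r. good r \<Longrightarrow> degree q \<le> degree r"
  shows "degree (gcd q (pderiv q)) = 0"
proof (rule ccontr)
  define g where "g = gcd q (pderiv q)"
  assume "degree (gcd q (pderiv q)) \<noteq> 0"
  then have g0: "degree g \<noteq> 0" unfolding g_def .
  have "g dvd q" by (simp add: g_def)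
  then obtain r where qr: "q = g * r" by (elim dvdE)
  have nz: "g \<noteq> 0" "r \<noteq> 0" using q unfolding good_def qr by auto
  have "g dvd pderiv q" by (simp add: g_def)
  then have red: "poly (eval_coeffs z r) l = 0"
    if "eval_coeffs z q \<noteq> 0" "poly (eval_coeffs z q) l = 0" for z l
    using eval_coeffs_pderiv_gcd that unfolding qr by blast
  have "{z. eval_coeffs z q = 0} \<subseteq> {z. poly (lead_coeff q) z = 0}"
  proof
    fix z assume "z \<in> {z. eval_coeffs z q = 0}"
    then have "coeff (eval_coeffs z q) (degree q) = 0" by simp
    then show "z \<in> {z. poly (lead_coeff q) z = 0}" by simp
  qed
  moreover have "finite {z. poly (lead_coeff q) z = 0}"
    using q unfolding good_def by (intro poly_roots_finite) simp
  ultimately have "finite {z. eval_coeffs z q = 0}" by (rule finite_subset)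
  moreover have "{z \<in> Z. \<exists>l \<in> ev z. poly (eval_coeffs z r) l \<noteq> 0} \<subseteq>
      {z \<in> Z. \<exists>l \<in> ev z. poly (eval_coeffs z q) l \<noteq> 0} \<union> {z. eval_coeffs z q = 0}"
    using red by blast
  ultimately have "good r"
    using q nz(2) unfolding good_def by (meson finite_UnI finite_subset)
  then have "degree q \<le> degree r" by (rule min)
  then show False using g0 nz by (simp add: qr degree_mult_eq)
qed

lemma finite_not_diagonalizable:
  fixes M :: "complex poly mat" and Z :: "complex set"
  defines "A \<equiv> \<lambda>z. map_mat (\<lambda>p. poly p z) M"
  assumes M: "M \<in> carrier_mat n n" and Z: "infinite Z"
    and diag: "\<And>z. z \<in> Z \<Longrightarrow> diagonalizable (A z)"
  shows "finite {z. \<not> diagonalizable (A z)}"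
proof -
  have A: "A z \<in> carrier_mat n n" for z using M by (simp add: A_def)
  define good where "good = (\<lambda>q :: complex poly poly. q \<noteq> 0 \<and>
    finite {z \<in> Z. \<exists>l \<in> Collect (eigenvalue (A z)). poly (eval_coeffs z q) l \<noteq> 0})"
  \<comment> \<open>The characteristic polynomial over the polynomial ring specializes to that of
    \<open>A z\<close>, so it has no exceptional points; it provides a starting point for the
    minimal choice.\<close>
  have "good (char_poly M)"
  proof -
    have "eval_coeffs z (char_poly M) = char_poly (A z)" for z
      unfolding A_def by (rule poly_hom.char_poly_hom[OF M, symmetric])
    then have "{z \<in> Z. \<exists>l \<in> Collect (eigenvalue (A z)). poly (eval_coeffs z (char_poly M)) l \<noteq> 0} = {}"
      using eigenvalue_root_char_poly[OF A] by auto
    moreover have "char_poly M \<noteq> 0" using degree_monic_char_poly[OF M] by auto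
    ultimately show ?thesis unfolding good_def by (simp only: finite.emptyI simp_thms)
  qed
  then obtain q where q: "good q" and min: "\<And>r. good r \<Longrightarrow> degree q \<le> degree r"
    using ex_has_least_nat[of good _ degree] by blast
  have "degree (gcd q (pderiv q)) = 0"
    by (rule gcd_pderiv_trivial_if_minimal[of q Z "\<lambda>z. Collect (eigenvalue (A z))"])
      (use q min in \<open>simp_all add: good_def\<close>)
  then have res: "resultant q (pderiv q) \<noteq> 0" by (simp add: resultant_0_gcd)
  have q0: "q \<noteq> 0" using q unfolding good_def by simp
  \<comment> \<open>Outside \<open>E\<close> both the degree of \<open>q\<close> and the
    nonvanishing of its resultant with the derivative survive specialization.\<close>
  define E where "E = {z. poly (lead_coeff q * resultant q (pderiv q)) z = 0}"
  have finE: "finite E" unfolding E_def using res q0 by (intro poly_roots_finite) simp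
  \<comment> \<open>These are the entries of \<open>q(z, A(z))\<close> as polynomials in
    \<open>z\<close>.\<close>
  define f where "f i j = (\<Sum>k\<le>degree q. coeff q k * (M ^\<^sub>m k) $$ (i,j))" for i j
  have poly_f: "poly (f i j) z
      = (\<Sum>k\<le>degree (eval_coeffs z q). coeff (eval_coeffs z q) k * (A z ^\<^sub>m k) $$ (i,j))"
    if ij: "i < n" "j < n" and z: "z \<notin> E" for i j z
  proof -
    have "(A z ^\<^sub>m k) $$ (i,j) = poly ((M ^\<^sub>m k) $$ (i,j)) z" for k
      unfolding A_def semiring_hom.mat_hom_pow[OF poly_hom.semiring_hom_axioms M, symmetric]
      using carrier_matD[OF pow_carrier_mat[OF M, of k]] ij by (simp only: index_map_mat)
    moreover have "degree (eval_coeffs z q) = degree q"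
      using z by (intro degree_eval_coeffs) (simp add: E_def)
    ultimately show ?thesis by (simp add: f_def poly_sum)
  qed
  have f0: "f i j = 0" if ij: "i < n" "j < n" for i j
  proof (rule ccontr)
    assume "f i j \<noteq> 0"
    then have "finite {z. poly (f i j) z = 0}" by (rule poly_roots_finite)
    moreover define bad where
      "bad = {z \<in> Z. \<exists>l \<in> Collect (eigenvalue (A z)). poly (eval_coeffs z q) l \<noteq> 0}"
    \<comment> \<open>On \<open>Z\<close> outside two finite sets, \<open>A z\<close> is
      diagonalizable with all eigenvalues among the roots of the specialized \<open>q\<close>, hence
      annihilated by it. A nonzero \<open>f i j\<close> would then have infinitely many
      roots.\<close>
    have "Z \<subseteq> {z. poly (f i j) z = 0} \<union> E \<union> bad"
    proof
      fix z assume z: "z \<in> Z"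
      have "poly (f i j) z = 0" if "z \<notin> E" "z \<notin> bad"
        unfolding poly_f[OF ij that(1)]
        using that(2) z diag[OF z] unfolding diagonalizable_def bad_def
        by (intro annihilator_diagonal[OF A _ _ ij]) auto
      then show "z \<in> {z. poly (f i j) z = 0} \<union> E \<union> bad" by blast
    qed
    moreover have "finite bad" using q unfolding good_def bad_def by simp
    ultimately show False using Z finE by (meson finite_UnI finite_subset)
  qed
  have "diagonalizable (A z)" if z: "z \<notin> E" for z
  proof -
    let ?q = "eval_coeffs z q"
    have deg: "degree ?q = degree q" using z by (intro degree_eval_coeffs) (simp add: E_def)
    have q'0: "?q \<noteq> 0"
    proof
      assume "?q = 0"
      then have "coeff ?q (degree q) = 0" by simp
      then show False using z by (simp add: E_def)
    qed
    have pd: "eval_coeffs z (pderiv q) = pderiv ?q" by (rule poly_hom.map_poly_pderiv)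
    \<comment> \<open>The resultant commutes with specialization here because both degrees are
      preserved; for the derivative this uses characteristic zero.\<close>
    have "resultant ?q (pderiv ?q) = poly (resultant q (pderiv q)) z"
      unfolding pd[symmetric]
      by (rule poly_hom.resultant_map_poly) (simp_all add: pd degree_pderiv deg)
    then have cop: "degree (gcd ?q (pderiv ?q)) = 0"
      using z resultant_0_gcd[of ?q "pderiv ?q"] by (simp add: E_def)
    have no_double: "\<not> (poly ?q l = 0 \<and> poly (pderiv ?q) l = 0)" for l
    proof
      assume "poly ?q l = 0 \<and> poly (pderiv ?q) l = 0"
      then have "[:-l,1:] dvd gcd ?q (pderiv ?q)" by (simp add: poly_eq_0_iff_dvd)
      then have "degree [:-l,1:] \<le> degree (gcd ?q (pderiv ?q))"
        using q'0 by (intro dvd_imp_degree_le) auto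
      then show False using cop by simp
    qed
    obtain es where es: "char_poly (A z) = (\<Prod>a\<leftarrow>es. [:- a, 1:])"
      using char_poly_factorized[OF A] by blast
    show ?thesis unfolding diagonalizable_def
    proof (rule similar_diagonal_if_no_chain[OF A es])
      fix u w l
      assume *: "u \<in> carrier_vec n" "w \<in> carrier_vec n"
        "A z *\<^sub>v u = l \<cdot>\<^sub>v u" "A z *\<^sub>v w = l \<cdot>\<^sub>v w + u"
      show "u = 0\<^sub>v n"
      proof (rule ccontr)
        assume u: "u \<noteq> 0\<^sub>v n"
        have "(\<Sum>k\<le>degree ?q. coeff ?q k * (A z ^\<^sub>m k) $$ (i,j)) = 0" if "i < n" "j < n" for i j
          using poly_f[OF that z] f0[OF that] by simp
        then show False
          using annihilator_chain_double_root[OF A * u, of ?q] no_double by blast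
      qed
    qed
  qed
  then have "{z. \<not> diagonalizable (A z)} \<subseteq> E" by blast
  then show ?thesis using finE by (rule finite_subset)
qed

section \<open>The system operator as a point of a Hermitian pencil\<close>

theorem proposition11:
  fixes N :: nat and \<alpha> \<eta> \<theta> R :: "real mat"
  assumes "1 \<le> N"
    and "\<alpha> \<in> carrier_mat N N" "\<eta> \<in> carrier_mat N N"
    and "\<theta> \<in> carrier_mat N N" "R \<in> carrier_mat N N"
    and "pos_def \<alpha>" and "pos_semidef \<eta>"
    and "transpose_mat \<theta> = - \<theta>"
    and "pos_semidef R" and "0 < vec_space.rank N R"
  shows "\<exists>E. finite E \<and> E \<subseteq> {0<..} \<and>
           (\<forall>\<beta> \<in> {0..} - E. diagonalizable (system_operator \<alpha> \<eta> \<theta> R \<beta>))"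
proof -
  define S where "S = mat_inv_sqrt \<alpha>"
  define T where "T = S * \<theta> * S"
  define H where "H = S * R * S"
  define F where "F = Phi_mat \<alpha> \<eta>"
  have S [simp]: "S \<in> carrier_mat N N" and S_sym: "transpose_mat S = S"
    unfolding S_def using mat_inv_sqrt_pos_def[OF assms(2,6)] by auto
  note mc = mult_carrier_mat[of _ N N _ N]
  have T: "T \<in> carrier_mat N N" and H: "H \<in> carrier_mat N N" and F: "F \<in> carrier_mat N N"
    unfolding T_def H_def F_def Phi_mat_def using assms(4,5) mat_sqrt_pos_semidef(3)[OF assms(3,7)] S
    by (auto intro!: mc simp flip: S_def)
  \<comment> \<open>Congruence by the symmetric \<open>S\<close> keeps \<open>T\<close>
    antisymmetric, which makes \<open>- 2 i T\<close>, and with it \<open>Om\<close>,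
    Hermitian.\<close>
  have T_sym: "transpose_mat T = - T"
    using assms(4,8) S_sym S carrier_matD[OF S] carrier_matD[OF assms(4)]
    by (simp add: T_def transpose_mult[of _ N N _ N] mc assoc_mult_mat[of _ N N _ N _ N])
  have H_sym: "transpose_mat H = H"
    using assms(5,9) S_sym S unfolding pos_semidef_def
    by (simp add: H_def transpose_mult[of _ N N _ N] mc assoc_mult_mat[of _ N N _ N _ N])
  have T_entry: "T $$ (j,i) = - T $$ (i,j)" if "i < N" "j < N" for i j
    using arg_cong[OF T_sym, of "\<lambda>B. B $$ (i,j)"] T that by simp
  have H_entry: "H $$ (j,i) = H $$ (i,j)" if "i < N" "j < N" for i j
    using arg_cong[OF H_sym, of "\<lambda>B. B $$ (i,j)"] H that by simp
  have \<alpha>: "dim_row \<alpha> = N" using assms(2) by simp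
  define Om where "Om = Omega_mat \<alpha> \<eta> \<theta>"
  define B where "B = B_mat \<alpha> R"
  have Om_eq: "Om = four_block_mat ((- 2 * \<i>) \<cdot>\<^sub>m cmat T) ((- \<i>) \<cdot>\<^sub>m cmat (transpose_mat F))
      (\<i> \<cdot>\<^sub>m cmat F) (0\<^sub>m N N)"
    unfolding Om_def Omega_mat_def T_def F_def S_def \<alpha> ..
  have B_eq: "B = four_block_mat (cmat H) (0\<^sub>m N N) (0\<^sub>m N N) (0\<^sub>m N N)"
    unfolding B_def B_mat_def H_def S_def \<alpha> ..
  have Om: "Om \<in> carrier_mat (N + N) (N + N)" and B: "B \<in> carrier_mat (N + N) (N + N)"
    unfolding Om_eq B_eq using T F H by auto
  have Om_herm: "cnj (Om $$ (j,i)) = Om $$ (i,j)" and B_herm: "cnj (B $$ (j,i)) = B $$ (i,j)"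
    if "i < N + N" "j < N + N" for i j
    unfolding Om_eq B_eq using that carrier_matD[OF T] carrier_matD[OF F] carrier_matD[OF H]
    by (auto simp: T_entry[of i j] H_entry[of i j])
  \<comment> \<open>Entrywise this is the pencil \<open>Om + z B\<close>, with \<open>z\<close> as
    the polynomial variable.\<close>
  define M where "M = mat (N + N) (N + N) (\<lambda>(i,j). [:Om $$ (i,j), B $$ (i,j):])"
  define A where "A z = map_mat (\<lambda>p. poly p z) M" for z
  have M: "M \<in> carrier_mat (N + N) (N + N)" by (simp add: M_def)
  have A: "A z \<in> carrier_mat (N + N) (N + N)" for z by (simp add: A_def M_def)
  have A_diag: "diagonalizable (A (of_real t))" for t
  proof -
    have adj: "map_mat conjugate (transpose_mat (A (of_real t))) = A (of_real t)"
      by (intro eq_matI) (auto simp: A_def M_def Om_herm B_herm)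
    obtain es where "char_poly (A (of_real t)) = (\<Prod>a\<leftarrow>es. [:- a, 1:])"
      using char_poly_factorized[OF A] by blast
    then show ?thesis
      unfolding diagonalizable_def
      by (rule similar_diagonal_if_no_chain[OF A]) (use self_adjoint_no_chain[OF A adj] in blast)
  qed
  have "infinite (range complex_of_real)"
    using infinite_UNIV_char_0[where ?'a = real] by (metis finite_imageD inj_of_real)
  then have fin: "finite {z. \<not> diagonalizable (A z)}"
    unfolding A_def by (rule finite_not_diagonalizable[OF M]) (use A_diag in \<open>auto simp: A_def\<close>)
  have sys: "system_operator \<alpha> \<eta> \<theta> R \<beta> = A (- \<i> * of_real \<beta>)" for \<beta>
    unfolding system_operator_def Om_def[symmetric] B_def[symmetric]
    using carrier_matD[OF Om] carrier_matD[OF B]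
    by (intro eq_matI) (auto simp: A_def M_def)
  \<comment> \<open>The exceptional parameters are pulled back along the injective map from
    \<open>\<beta>\<close> to \<open>- i \<beta>\<close>. The value zero is not among them, since
    there the pencil is Hermitian.\<close>
  define E where "E = {\<beta>. \<not> diagonalizable (A (- \<i> * of_real \<beta>))} \<inter> {0..}"
  have "inj (\<lambda>\<beta>. - \<i> * complex_of_real \<beta>)" by (intro injI) simp
  then have "finite ((\<lambda>\<beta>. - \<i> * complex_of_real \<beta>) -` {z. \<not> diagonalizable (A z)})"
    using fin by (intro finite_vimageI)
  then have "finite E" unfolding E_def by (simp add: vimage_def)
  moreover have "0 \<notin> E" using A_diag[of 0] by (simp add: E_def)
  then have "E \<subseteq> {0<..}" unfolding E_def by (auto simp: order_less_le)
  ultimately show ?thesis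
    unfolding sys by (intro exI[of _ E]) (auto simp: E_def)
qed

end
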